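(* Let $G$ be a finitely generated virtually abelian group, $N$ an abelian normal subgroup of finite index in $G$, $U$ a subset of $N$, and $\mathcal C$ a class of languages closed under finite unions and under intersection with regular languages. Then there exists a finite generating set $Z$ of $G$ such that if $\mathrm{Geo}_Z(U)\in\mathcal C$, then $\mathrm{ConjGeo}_Z(U)$ and $\mathrm{ConjMinLenSL}_Z(U)$ are both languages in $\mathcal C$.
   Context: For a group $G$ with finite generating set $Z\subseteq G$, let $\widetilde Z=Z\cup Z^{-1}$ and let $\pi:\widetilde Z^*\to G$ be the canonical surjective monoid homomorphism. For $g\in G$, $|g|$ is the length of a shortest word over $\widetilde Z$ representing $g$, and $|g|_c=\min\{|h| : h \text{ conjugate to } g\}$; $\ell(w)$ is the length of a word $w$. Fix a total order on $\widetilde Z$; $w_g$ denotes the shortlex-least word in $\widetilde Z^*$ representing $g$. For $U\subseteq G$ put $\alpha(U)=\bigcup_{g\in G}g^{-1}Ug$, and $$\mathrm{Geo}_Z(U)=\{w\in\widetilde Z^* : \ell(w)=|w\pi|,\ w\pi\in U\},$$ $$\mathrm{ConjGeo}_Z(U)=\{w\in\widetilde Z^* : \ell(w)=|w\pi|_c \text{ and } w\pi\in\alpha(U)\},$$ $$\mathrm{ConjMinLenSL}_Z(U)=\{w_g : g\in\alpha(U),\ |g|=|g|_c\}.$$ Convention: a class of languages is understood to be invariant under bijective renaming of the letters of the alphabet. *)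

theory Defs
  imports "HOL-Algebra.Algebra"
begin

text \<open>Words over a generating set are lists of group elements taken from the symmetrised
  generating set.\<close>

definition sym_gens :: "('a, 'b) monoid_scheme \<Rightarrow> 'a set \<Rightarrow> 'a set"
  where "sym_gens G Z = Z \<union> (\<lambda>z. inv\<^bsub>G\<^esub> z) ` Z"

definition word_eval :: "('a, 'b) monoid_scheme \<Rightarrow> 'a list \<Rightarrow> 'a"
  where "word_eval G w = foldr (\<lambda>x y. x \<otimes>\<^bsub>G\<^esub> y) w \<one>\<^bsub>G\<^esub>"

definition conj_closure :: "('a, 'b) monoid_scheme \<Rightarrow> 'a set \<Rightarrow> 'a set"
  where "conj_closure G U =
    (\<Union>g\<in>carrier G. (\<lambda>u. inv\<^bsub>G\<^esub> g \<otimes>\<^bsub>G\<^esub> u \<otimes>\<^bsub>G\<^esub> g) ` U)"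

definition word_length :: "('a, 'b) monoid_scheme \<Rightarrow> 'a set \<Rightarrow> 'a \<Rightarrow> nat"
  where "word_length G Z g =
    (LEAST n. \<exists>w\<in>lists (sym_gens G Z). word_eval G w = g \<and> length w = n)"

definition conj_length :: "('a, 'b) monoid_scheme \<Rightarrow> 'a set \<Rightarrow> 'a \<Rightarrow> nat"
  where "conj_length G Z g =
    (LEAST n. \<exists>h\<in>conj_closure G {g}. word_length G Z h = n)"

text \<open>The order \<open>r\<close> on the letters is reflexive, whereas \<^const>\<open>lenlex\<close> expects a
  strict one.\<close>

definition shortlex_rep ::
    "('a, 'b) monoid_scheme \<Rightarrow> 'a set \<Rightarrow> ('a \<times> 'a) set \<Rightarrow> 'a \<Rightarrow> 'a list"
  where "shortlex_rep G Z r g =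
    (THE w. w \<in> lists (sym_gens G Z) \<and> word_eval G w = g \<and>
       (\<forall>v\<in>lists (sym_gens G Z). word_eval G v = g \<and> v \<noteq> w \<longrightarrow> (w, v) \<in> lenlex (r - Id)))"

definition Geo :: "('a, 'b) monoid_scheme \<Rightarrow> 'a set \<Rightarrow> 'a set \<Rightarrow> 'a list set"
  where "Geo G Z U =
    {w \<in> lists (sym_gens G Z).
       length w = word_length G Z (word_eval G w) \<and> word_eval G w \<in> U}"

definition ConjGeo :: "('a, 'b) monoid_scheme \<Rightarrow> 'a set \<Rightarrow> 'a set \<Rightarrow> 'a list set"
  where "ConjGeo G Z U =
    {w \<in> lists (sym_gens G Z).
       length w = conj_length G Z (word_eval G w) \<and> word_eval G w \<in> conj_closure G U}"

definition ConjMinLenSL ::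
    "('a, 'b) monoid_scheme \<Rightarrow> 'a set \<Rightarrow> ('a \<times> 'a) set \<Rightarrow> 'a set \<Rightarrow> 'a list set"
  where "ConjMinLenSL G Z r U =
    {shortlex_rep G Z r g | g. g \<in> conj_closure G U \<and> word_length G Z g = conj_length G Z g}"

text \<open>Regular languages over the alphabet \<open>A\<close>: those accepted by a complete deterministic
  finite automaton, whose states may be taken to be natural numbers.\<close>

definition regular_language :: "'a set \<Rightarrow> 'a list set \<Rightarrow> bool"
  where "regular_language A L \<longleftrightarrow>
    (\<exists>(Q :: nat set) q0 F \<delta>.
       finite Q \<and> q0 \<in> Q \<and> F \<subseteq> Q \<and> (\<forall>q\<in>Q. \<forall>a\<in>A. \<delta> q a \<in> Q) \<and>
       L = {w \<in> lists A. foldl \<delta> q0 w \<in> F})"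

text \<open>A class of languages is a family \<open>C\<close>, where \<open>C A\<close> consists of the languages of the class
  over the finite alphabet \<open>A\<close>; a class that does not record alphabets is the special case
  \<open>C A = {L \<in> C\<^sub>0. L \<subseteq> lists A}\<close>. Values of \<open>C\<close> at infinite alphabets are irrelevant.\<close>

definition language_class :: "('a set \<Rightarrow> 'a list set set) \<Rightarrow> bool"
  where "language_class C \<longleftrightarrow>
    (\<forall>A. finite A \<longrightarrow> (\<forall>L\<in>C A. L \<subseteq> lists A)) \<and>
    (\<forall>A B f L. finite A \<and> bij_betw f A B \<and> L \<in> C A \<longrightarrow> map f ` L \<in> C B)"

definition closed_under_finite_unions :: "('a set \<Rightarrow> 'a list set set) \<Rightarrow> bool"
  where "closed_under_finite_unions C \<longleftrightarrow>
    (\<forall>A \<F>. finite A \<and> finite \<F> \<and> \<F> \<noteq> {} \<and> \<F> \<subseteq> C A \<longrightarrow> \<Union>\<F> \<in> C A)"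

definition closed_under_regular_inter :: "('a set \<Rightarrow> 'a list set set) \<Rightarrow> bool"
  where "closed_under_regular_inter C \<longleftrightarrow>
    (\<forall>A L R. finite A \<and> L \<in> C A \<and> regular_language A R \<longrightarrow> L \<inter> R \<in> C A)"

definition finitely_generated_group :: "('a, 'b) monoid_scheme \<Rightarrow> bool"
  where "finitely_generated_group G \<longleftrightarrow>
    group G \<and> (\<exists>S \<subseteq> carrier G. finite S \<and> generate G S = carrier G)"

end

theory Submission
  imports Defs "HOL-Library.Multiset"
begin

text \<open>The generating set is \<open>Z = B \<union> T\<close>, where \<open>B \<subseteq> N\<close> is finite and invariant under inversion and
  conjugation by \<open>G\<close>, the letters of \<open>T\<close> lie outside \<open>N\<close>, and every product of two letters of \<open>T\<close>
  lies in \<open>B\<close> or in \<open>BT\<close>.  Then geodesics of elements of \<open>N\<close> use letters of \<open>B\<close> only, so conjugation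
  preserves word length on \<open>N\<close> and acts on these geodesics by renaming letters.  Since the renamings are
  permutations of the finite set \<open>B\<close>, \<open>ConjGeo\<close> is a finite union of renamed copies of \<open>Geo\<close>.

  A geodesic over \<open>B\<close> is shortlex least iff it is sorted and no word over \<open>B\<close> of the same length and
  value is smaller.  As \<open>N\<close> is abelian, the letter counts of the sorted words that fail the
  latter condition form an upward closed set; by Dickson's lemma it is
  determined by truncated counts, which a finite automaton can compute.\<close>

section \<open>Dickson's lemma and truncated counts\<close>

text \<open>A monotone subsequence always exists; if it decreases, it is constant from the index of
  its minimum on.\<close>

lemma nat_seq_incseq_subseq:
  fixes s :: "nat \<Rightarrow> nat"
  shows "\<exists>f. strict_mono f \<and> incseq (\<lambda>n. s (f n))"
proof -
  obtain f where f: "strict_mono f" "monoseq (\<lambda>n. s (f n))"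
    using seq_monosub by blast
  show ?thesis
  proof (cases "incseq (\<lambda>n. s (f n))")
    case False
    then have dec: "decseq (\<lambda>n. s (f n))"
      using f(2) by (simp add: monoseq_iff)
    obtain k where k: "\<And>n. s (f k) \<le> s (f n)"
      using ex_has_least_nat[of "\<lambda>_. True" 0 "\<lambda>n. s (f n)"] by auto
    have "s (f (n + k)) = s (f k)" for n
      using k[of "n + k"] decseqD[OF dec, of k "n + k"] by simp
    then have "incseq (\<lambda>n. s (f (n + k)))"
      by (simp add: incseq_def)
    moreover have "strict_mono (\<lambda>n. f (n + k))"
      using f(1) by (simp add: strict_mono_def)
    ultimately show ?thesis by (intro exI[of _ "\<lambda>n. f (n + k)"]) simp
  qed (use f(1) in blast)
qed

text \<open>The subsequence is thinned once for each coordinate; coordinates already increasing stay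
  so under further thinning.\<close>

lemma dickson_incseq_subseq:
  fixes n :: "nat \<Rightarrow> 'a \<Rightarrow> nat"
  assumes "finite A"
  shows "\<exists>f. strict_mono f \<and> (\<forall>a\<in>A. incseq (\<lambda>i. n (f i) a))"
  using assms
proof (induction A rule: finite_induct)
  case empty
  then show ?case using strict_mono_id by auto
next
  case (insert b A)
  then obtain f where f: "strict_mono f" "\<And>a. a \<in> A \<Longrightarrow> incseq (\<lambda>i. n (f i) a)"
    by blast
  obtain g where g: "strict_mono g" "incseq (\<lambda>i. n (f (g i)) b)"
    using nat_seq_incseq_subseq[of "\<lambda>i. n (f i) b"] by blast
  have "incseq (\<lambda>i. n (f (g i)) a)" if "a \<in> A" for a
    using f(2)[OF that] strict_mono_mono[OF g(1)] by (simp add: incseq_def mono_def)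
  then show ?case
    using g f(1) by (intro exI[of _ "\<lambda>i. f (g i)"]) (auto simp: strict_mono_def)
qed

text \<open>If every bound failed, each would have a counterexample satisfying \<open>P\<close>. By
  Dickson, some truncated counterexample dominates an earlier one and so satisfies \<open>P\<close>
  after all.\<close>

lemma upward_closed_truncation:
  fixes P :: "('a \<Rightarrow> nat) \<Rightarrow> bool"
  assumes "finite A" and up: "\<And>m n. P m \<Longrightarrow> (\<And>a. a \<in> A \<Longrightarrow> m a \<le> n a) \<Longrightarrow> P n"
  shows "\<exists>K>0. \<forall>n. P n \<longleftrightarrow> P (\<lambda>a. min (n a) K)"
proof (rule ccontr)
  assume "\<not> ?thesis"
  moreover have "P n" if "P (\<lambda>a. min (n a) K)" for n K
    using up[OF that] by simp
  ultimately have "\<forall>K. \<exists>n. P n \<and> \<not> P (\<lambda>a. min (n a) (Suc K))"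
    by blast
  then obtain n where n: "\<And>K. P (n K)" "\<And>K. \<not> P (\<lambda>a. min (n K a) (Suc K))"
    by metis
  obtain f where f: "strict_mono f" "\<And>a. a \<in> A \<Longrightarrow> incseq (\<lambda>i. n (f i) a)"
    using dickson_incseq_subseq[OF assms(1), of n] by blast
  \<comment> \<open>\<open>j\<close> bounds every coordinate of \<open>n (f 0)\<close>, and
    \<open>f j\<close> is at least \<open>j\<close>, so truncating at \<open>Suc (f j)\<close>
    cannot fall below \<open>n (f 0)\<close>.\<close>
  define j where "j = (\<Sum>a\<in>A. n (f 0) a)"
  have "n (f 0) a \<le> min (n (f j) a) (Suc (f j))" if "a \<in> A" for a
  proof -
    have "n (f 0) a \<le> j"
      unfolding j_def using assms(1) that by (simp add: member_le_sum)
    then show ?thesis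
      using strict_mono_imp_increasing[OF f(1), of j] incseqD[OF f(2)[OF that], of 0 j] by simp
  qed
  then have "P (\<lambda>a. min (n (f j) a) (Suc (f j)))"
    by (rule up[OF n(1)])
  with n(2) show False by contradiction
qed

section \<open>Regularity from finite summaries of words\<close>

text \<open>The values of \<open>h\<close> become the states of an automaton, after being numbered
  by an injection into the naturals.\<close>

lemma regular_languageI:
  fixes h :: "'a list \<Rightarrow> 's"
  assumes fin: "finite S" and h: "\<And>w. w \<in> lists A \<Longrightarrow> h w \<in> S"
    and step: "\<And>w a. w \<in> lists A \<Longrightarrow> a \<in> A \<Longrightarrow> h (w @ [a]) = step (h w) a"
    and dec: "\<And>w. w \<in> lists A \<Longrightarrow> w \<in> L \<longleftrightarrow> acc (h w)" and "L \<subseteq> lists A"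
  shows "regular_language A L"
proof -
  obtain c :: "'s \<Rightarrow> nat" where c: "inj_on c S"
    using finite_imp_inj_to_nat_seg[OF fin] by blast
  \<comment> \<open>Only reachable values serve as states: closure of \<open>S\<close> under
    \<open>step\<close> is not given, whereas \<open>h\<close> itself supplies the successor of a
    reachable value.\<close>
  define S' where "S' = h ` lists A"
  have S': "S' \<subseteq> S" using h by (auto simp: S'_def)
  note c' = inj_on_subset[OF c S']
  define \<delta> where "\<delta> = (\<lambda>q a. c (step (the_inv_into S' c q) a))"
  have run: "foldl \<delta> (c (h [])) w = c (h w)" if "w \<in> lists A" for w
    using that
  proof (induction w rule: rev_induct)
    case (snoc a w)
    then have "h w \<in> S'" "w \<in> lists A" "a \<in> A" by (auto simp: S'_def)
    then show ?case using snoc.IH c' by (simp add: \<delta>_def step the_inv_into_f_f)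
  qed simp
  have closed: "\<delta> q a \<in> c ` S'" if q: "q \<in> c ` S'" and a: "a \<in> A" for q a
  proof -
    obtain w where w: "w \<in> lists A" "q = c (h w)" using q by (auto simp: S'_def)
    then have "\<delta> q a = c (h (w @ [a]))"
      using run[of "w @ [a]"] run[of w] a by simp
    then show ?thesis using w a by (auto simp: S'_def)
  qed
  have acc_iff: "foldl \<delta> (c (h [])) w \<in> c ` {s \<in> S'. acc s} \<longleftrightarrow> w \<in> L" if "w \<in> lists A" for w
    unfolding run[OF that] dec[OF that]
    using inj_on_image_mem_iff[OF c', of "h w" "{s \<in> S'. acc s}"] that
    by (auto simp: S'_def)
  show ?thesis
    unfolding regular_language_def
  proof (intro exI conjI ballI)
    show "finite (c ` S')" using finite_subset[OF S' fin] by simp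
    show "c (h []) \<in> c ` S'" by (auto simp: S'_def)
    show "c ` {s \<in> S'. acc s} \<subseteq> c ` S'" by blast
    show "\<delta> q a \<in> c ` S'" if "q \<in> c ` S'" "a \<in> A" for q a
      using closed that by blast
    show "L = {w \<in> lists A. foldl \<delta> (c (h [])) w \<in> c ` {s \<in> S'. acc s}}"
      using acc_iff \<open>L \<subseteq> lists A\<close> by blast
  qed
qed

text \<open>The automaton remembers the letter counts truncated at \<open>K\<close> and whether the
  word read so far is sorted.\<close>

lemma regular_sorted_avoiding_upward_closed:
  fixes P :: "('a \<Rightarrow> nat) \<Rightarrow> bool"
  assumes A: "finite A" and up: "\<And>m n. P m \<Longrightarrow> (\<And>a. a \<in> A \<Longrightarrow> m a \<le> n a) \<Longrightarrow> P n"
  shows "regular_language A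
    {w \<in> lists A. sorted_wrt (\<lambda>x y. (x, y) \<in> r) w \<and> \<not> P (count (mset w))}"
proof -
  let ?sorted = "sorted_wrt (\<lambda>x y. (x, y) \<in> r)"
  obtain K where K: "K > 0" "\<And>n. P n \<longleftrightarrow> P (\<lambda>a. min (n a) K)"
    using upward_closed_truncation[OF A, of P] up by metis
  \<comment> \<open>Restricting to \<open>A\<close> leaves finitely many truncated counts. The
    values outside \<open>A\<close> are harmless, since \<open>up\<close> compares counts on
    \<open>A\<close> only.\<close>
  define t where "t = (\<lambda>n. \<lambda>a\<in>A. min (n a) K)"
  have P_t: "P (t n) \<longleftrightarrow> P n" for n
  proof -
    have "P (t n) \<longleftrightarrow> P (\<lambda>a. min (n a) K)"
      by (intro iffI; erule up) (auto simp: t_def)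
    then show ?thesis using K(2) by blast
  qed
  define h where "h = (\<lambda>w. (t (count (mset w)), ?sorted w))"
  \<comment> \<open>Appending \<open>a\<close> keeps a word sorted iff \<open>a\<close> is above
    every letter seen. As \<open>K > 0\<close>, a positive truncated count tells exactly which
    letters occurred.\<close>
  define step where "step = (\<lambda>(n, b) a. (t (n(a := Suc (n a))), b \<and> (\<forall>x\<in>A. n x > 0 \<longrightarrow> (x, a) \<in> r)))"
  show ?thesis
  proof (rule regular_languageI)
    show "finite ((A \<rightarrow>\<^sub>E {..K}) \<times> (UNIV :: bool set))"
      using A by (simp add: finite_PiE)
    show "h w \<in> (A \<rightarrow>\<^sub>E {..K}) \<times> UNIV" for w
      by (auto simp: h_def t_def)
    show "h (w @ [a]) = step (h w) a" if "w \<in> lists A" "a \<in> A" for w a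
    proof -
      have "(\<forall>x\<in>A. t (count (mset w)) x > 0 \<longrightarrow> (x, a) \<in> r) \<longleftrightarrow> (\<forall>x\<in>set w. (x, a) \<in> r)"
        using that K(1) by (auto simp: t_def)
      moreover have "t (count (mset (w @ [a]))) = t ((t (count (mset w)))(a := Suc (t (count (mset w)) a)))"
        using that by (auto simp: t_def fun_eq_iff)
      ultimately show ?thesis
        by (simp add: h_def step_def sorted_wrt_append)
    qed
    show "w \<in> {w \<in> lists A. ?sorted w \<and> \<not> P (count (mset w))} \<longleftrightarrow> (\<lambda>(n, b). b \<and> \<not> P n) (h w)"
      if "w \<in> lists A" for w
      using that by (simp add: h_def P_t)
  qed auto
qed

section \<open>Sorted words and the lexicographic order\<close>

text \<open>For a transitive relation, sortedness is a condition on neighbours only.\<close>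

lemma not_sorted_wrt_descent:
  assumes "transp R" and "\<not> sorted_wrt R w"
  shows "\<exists>u a b v. w = u @ a # b # v \<and> \<not> R a b"
proof -
  have "\<not> successively R w"
    using assms by (simp add: successively_conv_sorted_wrt)
  then show ?thesis
  proof (induction w)
    case (Cons a w)
    then show ?case
    proof (cases w)
      case (Cons b v)
      show ?thesis
      proof (cases "R a b")
        case True
        then have "\<not> successively R w" using Cons Cons.prems by simp
        then show ?thesis using Cons.IH by (metis append_Cons)
      qed (use Cons in \<open>metis append_Nil\<close>)
    qed simp
  qed simp
qed

text \<open>The word \<open>v\<close> arises from \<open>w\<close> by exchanging the letters of
  \<open>w0\<close> for those of \<open>v0\<close>. Extra letters of \<open>w\<close> below the head
  of \<open>w0\<close> are copied, and so are common heads; the first place where \<open>v0\<close>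
  is smaller than \<open>w0\<close> makes \<open>v\<close> smaller than \<open>w\<close>.\<close>

lemma lex_sorted_supermultiset:
  assumes "antisym r" and "sorted_wrt (\<lambda>x y. (x, y) \<in> r) w0" and "sorted_wrt (\<lambda>x y. (x, y) \<in> r) w"
    and "mset w0 \<subseteq># mset w" and "(v0, w0) \<in> lex s"
  shows "\<exists>v. (v, w) \<in> lex s \<and> mset v + mset w0 = mset w + mset v0"
  using assms(2-)
proof (induction w arbitrary: w0 v0)
  case (Cons a w)
  obtain b w0' where w0: "w0 = b # w0'" using Cons.prems(4) by (cases w0) auto
  obtain c v0' where v0: "v0 = c # v0'" using Cons.prems(4) w0 by (cases v0) (auto simp: lex_conv)
  show ?case
  proof (cases "a = b")
    case True
    have sub: "mset w0' \<subseteq># mset w" using Cons.prems(3) True w0 by simp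
    consider "(c, b) \<in> s" "length v0' = length w0'" | "c = b" "(v0', w0') \<in> lex s"
      using Cons.prems(4) w0 v0 by auto
    then show ?thesis
    proof cases
      case 1
      obtain M where M: "mset w = mset w0' + M"
        using sub by (auto simp: mset_subset_eq_exists_conv)
      \<comment> \<open>The comparison is decided at the first letter, so the remaining letters may
        come in any order; \<open>lex\<close> only demands equal lengths.\<close>
      obtain v' where v': "mset v' = M + mset v0'" using ex_mset by blast
      have "size (mset v') = size (mset w)"
        unfolding v' M using 1 by simp
      then have "(c # v', a # w) \<in> lex s" using 1 True by simp
      moreover have "mset (c # v') + mset w0 = mset (a # w) + mset v0"
        using True M v' w0 v0 by simp
      ultimately show ?thesis by blast
    next
      case 2
      then obtain v where "(v, w) \<in> lex s" "mset v + mset w0' = mset w + mset v0'"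
        using Cons.IH[of w0' v0'] Cons.prems w0 sub by auto
      then show ?thesis using 2 True w0 v0 by (intro exI[of _ "a # v"]) simp
    qed
  next
    case False
    have "b \<in> set w" using Cons.prems(3) w0 False by (auto dest: mset_subset_eqD)
    then have "(a, b) \<in> r" using Cons.prems(2) by simp
    \<comment> \<open>The letter \<open>a\<close> lies strictly below all of \<open>w0\<close>, so
      \<open>w0\<close> is already contained in the tail \<open>w\<close> and \<open>a\<close> can
      be kept.\<close>
    then have "a \<notin> set w0"
      using Cons.prems(1) w0 False \<open>antisym r\<close> by (auto dest: antisymD)
    then have a: "count (mset w0) a = 0" by (simp add: count_eq_zero_iff)
    have "count (mset w0) x \<le> count (mset w) x" for x
    proof (cases "x = a")
      case True
      show ?thesis unfolding True a by simp
    next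
      case False
      then show ?thesis using mset_subset_eq_count[OF Cons.prems(3), of x] by simp
    qed
    then have "mset w0 \<subseteq># mset w" by (simp add: subseteq_mset_def)
    then obtain v where "(v, w) \<in> lex s" "mset v + mset w0 = mset w + mset v0"
      using Cons.IH[of w0 v0] Cons.prems by auto
    then show ?thesis by (intro exI[of _ "a # v"]) simp
  qed
qed simp

section \<open>Word length and shortlex representatives\<close>

lemma word_eval_simps [simp]:
  "word_eval G [] = \<one>\<^bsub>G\<^esub>" "word_eval G (a # w) = a \<otimes>\<^bsub>G\<^esub> word_eval G w"
  by (simp_all add: word_eval_def)

lemma word_length_le: "w \<in> lists (sym_gens G Z) \<Longrightarrow> word_length G Z (word_eval G w) \<le> length w"
  unfolding word_length_def by (rule Least_le) blast

lemma geodesic_word_exists: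
  assumes "w \<in> lists (sym_gens G Z)" and "word_eval G w = g"
  shows "\<exists>v\<in>lists (sym_gens G Z). word_eval G v = g \<and> length v = word_length G Z g"
  unfolding word_length_def by (rule LeastI[of _ "length w"]) (use assms in blast)

lemma shortlex_rep_eqI:
  assumes "asym (r - Id)" and w: "w \<in> lists (sym_gens G Z)" "word_eval G w = g"
    and least: "\<And>v. v \<in> lists (sym_gens G Z) \<Longrightarrow> word_eval G v = g \<Longrightarrow> v \<noteq> w \<Longrightarrow> (w, v) \<in> lenlex (r - Id)"
  shows "shortlex_rep G Z r g = w"
  unfolding shortlex_rep_def
proof (rule the_equality)
  fix v
  assume "v \<in> lists (sym_gens G Z) \<and> word_eval G v = g \<and>
    (\<forall>u\<in>lists (sym_gens G Z). word_eval G u = g \<and> u \<noteq> v \<longrightarrow> (v, u) \<in> lenlex (r - Id))"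
  then show "v = w"
    using w least[of v] asym_lenlex[OF \<open>asym (r - Id)\<close>] by (auto dest: asymD)
qed (use w least in blast)

lemma lex_total_on_lists:
  assumes "total_on A r" "v \<in> lists A" "w \<in> lists A" "length v = length w" "v \<noteq> w"
  shows "(v, w) \<in> lex r \<or> (w, v) \<in> lex r"
  using assms(2-)
proof (induction v arbitrary: w)
  case (Cons a v)
  then obtain b w' where w: "w = b # w'" by (cases w) auto
  have "a = b \<or> (a, b) \<in> r \<or> (b, a) \<in> r"
    using Cons.hyps Cons.prems(1) w \<open>total_on A r\<close> unfolding total_on_def by auto
  then show ?case
    using Cons.IH[of w'] Cons.prems w by (cases "a = b") auto
qed simp

text \<open>A linear order on a finite alphabet is well-founded, hence so is \<open>lenlex\<close>;
  a minimal word for \<open>g\<close> exists and is least by totality. This justifies the definite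
  description.\<close>

lemma shortlex_rep_least:
  assumes "finite A" "linear_order_on A r" and A: "sym_gens G Z = A"
    and u: "u \<in> lists A" "word_eval G u = g"
  shows "shortlex_rep G Z r g \<in> lists A" "word_eval G (shortlex_rep G Z r g) = g"
    "\<And>v. v \<in> lists A \<Longrightarrow> word_eval G v = g \<Longrightarrow> v \<noteq> shortlex_rep G Z r g \<Longrightarrow>
      (shortlex_rep G Z r g, v) \<in> lenlex (r - Id)"
proof -
  have "finite r"
    using assms(1,2) by (auto simp: order_on_defs intro: finite_subset)
  then have wf: "wf (r - Id)"
    using partial_order_on_well_order_on assms(2) by (auto simp: linear_order_on_def)
  have tot: "total_on A (r - Id)"
    using assms(2) by (auto simp: linear_order_on_def total_on_def)
  obtain w where w: "w \<in> lists A" "word_eval G w = g"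
    and min: "\<And>v. (v, w) \<in> lenlex (r - Id) \<Longrightarrow> \<not> (v \<in> lists A \<and> word_eval G v = g)"
    using wfE_min[OF wf_lenlex[OF wf], of u "{w \<in> lists A. word_eval G w = g}"] u
    by (metis (mono_tags, lifting) mem_Collect_eq)
  have least: "(w, v) \<in> lenlex (r - Id)" if "v \<in> lists A" "word_eval G v = g" "v \<noteq> w" for v
    using min[of v] that lex_total_on_lists[OF tot that(1) w(1)]
    unfolding lenlex_conv by (cases "length v" "length w" rule: linorder_cases) auto
  have "shortlex_rep G Z r g = w"
    by (rule shortlex_rep_eqI) (use w least A wf_imp_asym[OF wf] in auto)
  then show "shortlex_rep G Z r g \<in> lists A" "word_eval G (shortlex_rep G Z r g) = g"
    "\<And>v. v \<in> lists A \<Longrightarrow> word_eval G v = g \<Longrightarrow> v \<noteq> shortlex_rep G Z r g \<Longrightarrow>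
      (shortlex_rep G Z r g, v) \<in> lenlex (r - Id)"
    using w least by auto
qed

lemma language_class_rename:
  assumes "language_class C" "finite A" "bij_betw f A B" "L \<in> C A"
  shows "map f ` L \<in> C B"
proof -
  have "\<forall>A B f L. finite A \<and> bij_betw f A B \<and> L \<in> C A \<longrightarrow> map f ` L \<in> C B"
    using assms(1) unfolding language_class_def by (rule conjunct2)
  then show ?thesis using assms(2-4) by blast
qed

section \<open>Conjugation and evaluation of words\<close>

context group
begin

definition conj_by :: "'a \<Rightarrow> 'a \<Rightarrow> 'a"
  where "conj_by g z = inv g \<otimes> z \<otimes> g"

lemma conj_closure_eq: "conj_closure G U = (\<Union>g\<in>carrier G. conj_by g ` U)"
  by (simp add: conj_closure_def conj_by_def)

lemma conj_by_closed [simp]: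
  "g \<in> carrier G \<Longrightarrow> z \<in> carrier G \<Longrightarrow> conj_by g z \<in> carrier G"
  by (simp add: conj_by_def)

lemma conj_by_one: "z \<in> carrier G \<Longrightarrow> conj_by \<one> z = z"
  by (simp add: conj_by_def)

lemma conj_by_mult:
  assumes "g \<in> carrier G" "y \<in> carrier G" "z \<in> carrier G"
  shows "conj_by g (y \<otimes> z) = conj_by g y \<otimes> conj_by g z"
proof -
  have "g \<otimes> (inv g \<otimes> (z \<otimes> g)) = z \<otimes> g"
    using assms by (simp flip: m_assoc)
  then show ?thesis using assms by (simp add: conj_by_def m_assoc)
qed

lemma word_eval_closed: "w \<in> lists (carrier G) \<Longrightarrow> word_eval G w \<in> carrier G"
  by (induction w) auto

lemma word_eval_append:
  assumes "v \<in> lists (carrier G)" "w \<in> lists (carrier G)"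
  shows "word_eval G (v @ w) = word_eval G v \<otimes> word_eval G w"
  using assms by (induction v) (auto simp: word_eval_closed m_assoc)

lemma sym_gens_closed: "Z \<subseteq> carrier G \<Longrightarrow> sym_gens G Z \<subseteq> carrier G"
  by (auto simp: sym_gens_def)

lemma generate_word:
  assumes Z: "Z \<subseteq> carrier G" and "g \<in> generate G Z"
  shows "\<exists>w\<in>lists (sym_gens G Z). word_eval G w = g"
  using assms(2)
proof (induction rule: generate.induct)
  case one
  then show ?case by (intro bexI[of _ "[]"]) auto
next
  case (incl h)
  then show ?case using Z by (intro bexI[of _ "[h]"]) (auto simp: sym_gens_def)
next
  case (inv h)
  then show ?case using Z by (intro bexI[of _ "[inv h]"]) (auto simp: sym_gens_def)
next
  case (eng h1 h2)
  then obtain v w where "v \<in> lists (sym_gens G Z)" "w \<in> lists (sym_gens G Z)"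
    "word_eval G v = h1" "word_eval G w = h2" by blast
  then show ?case
    using word_eval_append[of v w] sym_gens_closed[OF Z]
    by (intro bexI[of _ "v @ w"]) auto
qed

lemma conj_by_conj_by:
  assumes "g \<in> carrier G" "h \<in> carrier G" "z \<in> carrier G"
  shows "conj_by h (conj_by g z) = conj_by (g \<otimes> h) z"
  using assms by (simp add: conj_by_def inv_mult_group m_assoc)

lemma conj_by_inv_conj_by:
  assumes "g \<in> carrier G" "z \<in> carrier G"
  shows "conj_by (inv g) (conj_by g z) = z" "conj_by g (conj_by (inv g) z) = z"
  using assms by (simp_all add: conj_by_conj_by conj_by_one)

lemma inv_conj_by:
  assumes "g \<in> carrier G" "z \<in> carrier G"
  shows "inv (conj_by g z) = conj_by g (inv z)"
  using assms by (simp add: conj_by_def inv_mult_group m_assoc)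

lemma word_eval_map_conj_by:
  assumes "g \<in> carrier G" "w \<in> lists (carrier G)"
  shows "word_eval G (map (conj_by g) w) = conj_by g (word_eval G w)"
  using assms(2)
proof (induction w)
  case (Cons a w)
  then show ?case
    using assms(1) by (auto simp: conj_by_mult word_eval_closed)
qed (use assms(1) in \<open>simp add: conj_by_def\<close>)

end

lemma (in normal) conj_by_in_normal: "g \<in> carrier G \<Longrightarrow> h \<in> H \<Longrightarrow> conj_by g h \<in> H"
  by (simp add: conj_by_def inv_op_closed1)

lemma (in subgroup) mult_mem_iff:
  assumes "group G" "h \<in> H" "g \<in> carrier G"
  shows "h \<otimes> g \<in> H \<longleftrightarrow> g \<in> H" "g \<otimes> h \<in> H \<longleftrightarrow> g \<in> H"
proof -
  interpret group G by fact
  have "inv h \<otimes> (h \<otimes> g) = g" using assms(2,3) by (simp flip: m_assoc)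
  then show "h \<otimes> g \<in> H \<longleftrightarrow> g \<in> H" using assms(2)
    by (metis subgroup.m_closed[OF subgroup_axioms] subgroup.m_inv_closed[OF subgroup_axioms])
  have "g \<otimes> h \<otimes> inv h = g" using assms(2,3) by (simp add: m_assoc)
  then show "g \<otimes> h \<in> H \<longleftrightarrow> g \<in> H" using assms(2)
    by (metis subgroup.m_closed[OF subgroup_axioms] subgroup.m_inv_closed[OF subgroup_axioms])
qed

section \<open>Generating sets adapted to an abelian normal subgroup\<close>

text \<open>Closure under inversion makes the symmetrised alphabet equal to
  \<open>B \<union> T\<close>. \<open>B_conj\<close> lets conjugation act on words over
  \<open>B\<close> letter by letter. \<open>T_mult_in_B\<close> shortens a word, while
  \<open>T_mult_in_BT\<close> rewrites it at equal length.\<close>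

locale adapted_generators = normal N G for N and G (structure) +
  fixes B T :: "'a set"
  assumes N_comm: "\<lbrakk>a \<in> N; b \<in> N\<rbrakk> \<Longrightarrow> a \<otimes> b = b \<otimes> a"
    and B_subset: "B \<subseteq> N" and B_finite: "finite B"
    and B_inv: "x \<in> B \<Longrightarrow> inv x \<in> B"
    and B_conj: "\<lbrakk>g \<in> carrier G; x \<in> B\<rbrakk> \<Longrightarrow> conj_by g x \<in> B"
    and T_subset: "T \<subseteq> carrier G - N" and T_finite: "finite T"
    and T_inv: "y \<in> T \<Longrightarrow> inv y \<in> T"
    and T_mult_in_B: "\<lbrakk>y \<in> T; z \<in> T; y \<otimes> z \<in> N\<rbrakk> \<Longrightarrow> y \<otimes> z \<in> B"
    and T_mult_in_BT: "\<lbrakk>y \<in> T; z \<in> T; y \<otimes> z \<notin> N\<rbrakk> \<Longrightarrow> \<exists>x\<in>B. \<exists>y'\<in>T. y \<otimes> z = x \<otimes> y'"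
    and generates: "generate G (B \<union> T) = carrier G"
begin

abbreviation letters :: "'a set" where "letters \<equiv> B \<union> T"

lemma letters_closed: "letters \<subseteq> carrier G" and B_closed: "B \<subseteq> carrier G"
  using B_subset T_subset subset by auto

lemma sym_gens_letters [simp]: "sym_gens G letters = letters"
  using B_inv T_inv by (auto simp: sym_gens_def)

lemma finite_letters: "finite letters"
  using B_finite T_finite by simp

lemma lists_letters_carrier: "w \<in> lists letters \<Longrightarrow> w \<in> lists (carrier G)"
  and lists_B_letters: "w \<in> lists B \<Longrightarrow> w \<in> lists letters"
  and lists_B_carrier: "w \<in> lists B \<Longrightarrow> w \<in> lists (carrier G)"
  using letters_closed by blast+

lemma word_eval_N: "w \<in> lists B \<Longrightarrow> word_eval G w \<in> N"
  using B_subset by (induction w) auto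

lemma conj_word_B:
  assumes "g \<in> carrier G" "w \<in> lists B"
  shows "map (conj_by g) w \<in> lists B"
  using assms B_conj by auto

lemma letter_word_exists: "g \<in> carrier G \<Longrightarrow> \<exists>w\<in>lists letters. word_eval G w = g"
  using generate_word[OF letters_closed] generates by simp

text \<open>All letters lie in the abelian group \<open>N\<close>, so the head of one word can be
  pulled to the front of the other.\<close>

lemma word_eval_mset_cong:
  assumes "v \<in> lists B" "w \<in> lists B" "mset v = mset w"
  shows "word_eval G v = word_eval G w"
  using assms
proof (induction v arbitrary: w)
  case (Cons a v)
  then have "a \<in> set w" by (metis list.set_intros(1) set_mset_mset)
  then obtain w1 w2 where w: "w = w1 @ a # w2" by (meson split_list)
  have in_B: "a \<in> B" "w1 \<in> lists B" "w2 \<in> lists B" using Cons.prems w by auto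
  have in_N: "a \<in> N" "word_eval G w1 \<in> N" "word_eval G w2 \<in> N"
    using in_B B_subset word_eval_N by auto
  have "word_eval G v = word_eval G (w1 @ w2)"
    using Cons.IH[of "w1 @ w2"] Cons.prems in_B w by simp
  then have "word_eval G (a # v) = a \<otimes> (word_eval G w1 \<otimes> word_eval G w2)"
    using in_B lists_B_carrier by (simp add: word_eval_append)
  also have "\<dots> = word_eval G w1 \<otimes> (a \<otimes> word_eval G w2)"
    using in_N N_comm[of a "word_eval G w1"] by (simp add: mem_carrier flip: m_assoc)
  also have "\<dots> = word_eval G w"
    using in_B lists_B_carrier B_closed w by (simp add: word_eval_append subsetD)
  finally show ?case .
qed simp

text \<open>Letters of \<open>T\<close> are moved to the right end, where two of them merge into one letter of \<open>B\<close> if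
  their product lies in \<open>N\<close> and are replaced by a word in \<open>BT\<close> otherwise.  A word representing an element
  of \<open>N\<close> cannot end with a single letter of \<open>T\<close>, so some merge must have shortened it.\<close>

lemma collect_T_letters:
  assumes "w \<in> lists letters"
  shows "(word_eval G w \<in> N \<and> (\<exists>u\<in>lists B. word_eval G u = word_eval G w \<and>
        length u \<le> length w \<and> (w \<notin> lists B \<longrightarrow> length u < length w))) \<or>
      (word_eval G w \<notin> N \<and> (\<exists>u\<in>lists B. \<exists>y\<in>T. word_eval G w = word_eval G u \<otimes> y \<and>
        length u < length w))"
  using assms
proof (induction w)
  case (Cons a w)
  have a: "a \<in> letters" "a \<in> carrier G" using Cons.hyps letters_closed by auto
  have w: "word_eval G w \<in> carrier G"
    using Cons.hyps lists_letters_carrier[of w] by (simp add: word_eval_closed)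
  \<comment> \<open>Moving \<open>a\<close> to the right past \<open>u\<close> conjugates each
    letter of \<open>u\<close>, which keeps the length and stays in \<open>B\<close>.\<close>
  have move: "a \<otimes> word_eval G u = word_eval G (map (conj_by (inv a)) u) \<otimes> a"
    and moved: "map (conj_by (inv a)) u \<in> lists B" if "u \<in> lists B" for u
    using that a conj_word_B[of "inv a" u] word_eval_map_conj_by[of "inv a" u] lists_B_carrier[of u]
    by (auto simp: conj_by_def m_assoc word_eval_closed)
  \<comment> \<open>In the second case the word is \<open>u\<close> followed by \<open>y\<close>;
    the strict bound on \<open>u\<close> leaves room for that last letter.\<close>
  consider (in_N) u where "word_eval G w \<in> N" "u \<in> lists B" "word_eval G u = word_eval G w"
      "length u \<le> length w" "w \<notin> lists B \<longrightarrow> length u < length w"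
    | (off_N) u y where "word_eval G w \<notin> N" "u \<in> lists B" "y \<in> T"
      "word_eval G w = word_eval G u \<otimes> y" "length u < length w"
    using Cons.IH by blast
  then show ?case
  proof cases
    case in_N
    show ?thesis
    proof (cases "a \<in> B")
      case True
      then show ?thesis using in_N B_subset by (intro disjI1 conjI bexI[of _ "a # u"]) auto
    next
      case False
      then have "a \<in> T" using a by simp
      then have "a \<notin> N" using T_subset by auto
      then have "a \<otimes> word_eval G w \<notin> N"
        using in_N(1) a mult_mem_iff(2)[OF is_group] by blast
      then show ?thesis
        using in_N \<open>a \<in> T\<close> move[OF in_N(2)] moved[OF in_N(2)]
        by (intro disjI2 conjI bexI[of _ "map (conj_by (inv a)) u"] bexI[of _ a]) auto
    qed
  next
    case off_N
    have y: "y \<in> carrier G" "y \<notin> N" using off_N T_subset by auto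
    have u: "word_eval G u \<in> N" "word_eval G u \<in> carrier G"
      using off_N word_eval_N mem_carrier by auto
    show ?thesis
    proof (cases "a \<in> B")
      case True
      then have "a \<in> N" using B_subset by auto
      then have "a \<otimes> word_eval G w \<notin> N"
        using off_N(1) w mult_mem_iff(1)[OF is_group] by blast
      then show ?thesis using True a off_N y u
        by (intro disjI2 conjI bexI[of _ "a # u"] bexI[of _ y]) (auto simp: m_assoc)
    next
      case False
      then have "a \<in> T" using a by simp
      define v where "v = map (conj_by (inv a)) u"
      have v: "v \<in> lists B" "length v = length u" "word_eval G v \<in> N" "word_eval G v \<in> carrier G"
        unfolding v_def using moved[OF off_N(2)] word_eval_N mem_carrier by auto
      have eq: "a \<otimes> word_eval G w = word_eval G v \<otimes> (a \<otimes> y)"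
        using a y u v(4) move[OF off_N(2)] off_N(4) by (simp add: v_def m_assoc flip: m_assoc[of a])
      show ?thesis
      proof (cases "a \<otimes> y \<in> N")
        case True
        \<comment> \<open>This merge gives the strict decrease: two letters of \<open>T\<close>
          become one letter of \<open>B\<close>, so the new length is at most that of
          \<open>w\<close>.\<close>
        have "a \<otimes> y \<in> B" using T_mult_in_B \<open>a \<in> T\<close> off_N(3) True by blast
        moreover have "word_eval G (v @ [a \<otimes> y]) = a \<otimes> word_eval G w"
          using eq a y v lists_B_carrier[of v] by (simp add: word_eval_append)
        ultimately show ?thesis
          using eq v True off_N(5)
          by (intro disjI1 conjI bexI[of _ "v @ [a \<otimes> y]"]) auto
      next
        case False
        then obtain x y' where xy: "x \<in> B" "y' \<in> T" "a \<otimes> y = x \<otimes> y'"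
          using T_mult_in_BT \<open>a \<in> T\<close> off_N(3) by blast
        have closed: "x \<in> carrier G" "y' \<in> carrier G" using xy B_closed T_subset by auto
        have "word_eval G v \<otimes> (a \<otimes> y) \<notin> N"
          using False v(3) a y mult_mem_iff(1)[OF is_group, of "word_eval G v" "a \<otimes> y"] by simp
        moreover have "word_eval G (v @ [x]) \<otimes> y' = a \<otimes> word_eval G w"
          using eq closed xy v lists_B_carrier[of v] by (simp add: word_eval_append m_assoc)
        ultimately show ?thesis
          using eq v xy off_N(5)
          by (intro disjI2 conjI bexI[of _ "v @ [x]"] bexI[of _ y']) auto
      qed
    qed
  qed
qed simp

section \<open>Geodesics in \<open>N\<close>, conjugation, and membership of \<open>ConjGeo\<close>
  in the class\<close>

lemma geodesic_in_lists_B: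
  assumes "w \<in> lists letters" "word_eval G w \<in> N" "length w = word_length G letters (word_eval G w)"
  shows "w \<in> lists B"
proof (rule ccontr)
  assume "w \<notin> lists B"
  then obtain u where "u \<in> lists B" "word_eval G u = word_eval G w" "length u < length w"
    using collect_T_letters[OF assms(1)] assms(2) by blast
  then show False
    using word_length_le[of u G letters] lists_B_letters[of u] assms(3) by simp
qed

text \<open>A geodesic of \<open>n\<close> uses letters of \<open>B\<close> only, so conjugating it
  letter by letter gives a word for the conjugate of the same length.\<close>

lemma word_length_conj_le:
  assumes "g \<in> carrier G" "n \<in> N"
  shows "word_length G letters (conj_by g n) \<le> word_length G letters n"
proof -
  obtain w where w: "w \<in> lists letters" "word_eval G w = n" "length w = word_length G letters n"
    using letter_word_exists[of n] geodesic_word_exists[of _ G letters n] assms mem_carrier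
    by (metis sym_gens_letters)
  then have "w \<in> lists B" using geodesic_in_lists_B assms by simp
  then show ?thesis
    using word_length_le[of "map (conj_by g) w" G letters] w assms
      word_eval_map_conj_by[OF assms(1) lists_B_carrier] lists_B_letters[OF conj_word_B[OF assms(1)]]
    by simp
qed

lemma word_length_conj:
  assumes "g \<in> carrier G" "n \<in> N"
  shows "word_length G letters (conj_by g n) = word_length G letters n"
  using word_length_conj_le[OF assms] word_length_conj_le[of "inv g" "conj_by g n"]
    conj_by_inv_conj_by(1)[of g n] conj_by_in_normal[OF assms] assms
  by (simp add: mem_carrier)

text \<open>All conjugates of \<open>n\<close> have the same word length, so the minimum ranges over
  a single value.\<close>

lemma conj_length_eq_word_length:
  assumes "n \<in> N"
  shows "conj_length G letters n = word_length G letters n"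
proof -
  have "(\<exists>h\<in>conj_closure G {n}. word_length G letters h = k) \<longleftrightarrow> k = word_length G letters n" for k
    using word_length_conj[OF _ assms] by (auto simp: conj_closure_eq)
  then show ?thesis unfolding conj_length_def by (intro Least_equality) auto
qed

lemma conj_closure_subset: "U \<subseteq> N \<Longrightarrow> conj_closure G U \<subseteq> N"
  using conj_by_in_normal by (auto simp: conj_closure_eq)

lemma Geo_subset_lists_B: "U \<subseteq> N \<Longrightarrow> Geo G letters U \<subseteq> lists B"
  using geodesic_in_lists_B by (auto simp: Geo_def)

lemma ConjGeo_eq_Geo_conj_closure:
  "U \<subseteq> N \<Longrightarrow> ConjGeo G letters U = Geo G letters (conj_closure G U)"
  using conj_closure_subset[of U] conj_length_eq_word_length by (auto simp: ConjGeo_def Geo_def)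

lemma map_conj_Geo_subset:
  assumes "g \<in> carrier G" "U \<subseteq> N" "w \<in> Geo G letters U"
  shows "map (conj_by g) w \<in> Geo G letters (conj_by g ` U)"
proof -
  have w: "w \<in> lists B" using Geo_subset_lists_B assms by blast
  then have "length w = word_length G letters (conj_by g (word_eval G w))"
    using assms by (auto simp: word_length_conj Geo_def)
  then show ?thesis
    using assms lists_B_letters[OF conj_word_B[OF assms(1) w]]
      word_eval_map_conj_by[OF assms(1) lists_B_carrier[OF w]]
    by (auto simp: Geo_def)
qed

lemma Geo_conj_closure:
  assumes "U \<subseteq> N"
  shows "Geo G letters (conj_closure G U) = (\<Union>g\<in>carrier G. map (conj_by g) ` Geo G letters U)"
proof
  show "(\<Union>g\<in>carrier G. map (conj_by g) ` Geo G letters U) \<subseteq> Geo G letters (conj_closure G U)"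
    using map_conj_Geo_subset[OF _ assms] by (fastforce simp: Geo_def conj_closure_eq)
  show "Geo G letters (conj_closure G U) \<subseteq> (\<Union>g\<in>carrier G. map (conj_by g) ` Geo G letters U)"
  proof
    fix w assume w: "w \<in> Geo G letters (conj_closure G U)"
    then obtain g u where gu: "g \<in> carrier G" "u \<in> U" "word_eval G w = conj_by g u"
      by (auto simp: Geo_def conj_closure_eq)
    have "u \<in> carrier G" using gu assms mem_carrier by auto
    \<comment> \<open>Narrowing the target set to one element ensures that conjugating back by
      \<open>inv g\<close> lands on \<open>u\<close> itself.\<close>
    have "w \<in> Geo G letters {conj_by g u}" using w gu by (auto simp: Geo_def)
    moreover have "{conj_by g u} \<subseteq> N" using gu assms conj_by_in_normal by auto
    ultimately have "map (conj_by (inv g)) w \<in> Geo G letters {conj_by (inv g) (conj_by g u)}"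
      using map_conj_Geo_subset[of "inv g" "{conj_by g u}"] gu by simp
    then have v: "map (conj_by (inv g)) w \<in> Geo G letters U"
      using gu \<open>u \<in> carrier G\<close> by (auto simp: Geo_def conj_by_inv_conj_by(1))
    have "w \<in> lists (carrier G)" using w letters_closed by (auto simp: Geo_def)
    then have "map (conj_by g) (map (conj_by (inv g)) w) = w"
      using gu(1) by (simp add: map_idI conj_by_inv_conj_by(2) subset_iff lists_eq_set)
    then show "w \<in> (\<Union>g\<in>carrier G. map (conj_by g) ` Geo G letters U)"
      using v gu(1) by (metis UN_I imageI)
  qed
qed

lemma conj_by_bij_B:
  assumes "g \<in> carrier G"
  shows "bij_betw (conj_by g) B B"
  by (rule bij_betw_byWitness[where f' = "conj_by (inv g)"])
    (use assms B_conj B_conj[of "inv g"] B_closed conj_by_inv_conj_by in auto)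

text \<open>Renaming requires a bijection of the whole alphabet, but conjugation is only known to
  permute \<open>B\<close>. The map \<open>f\<close> therefore fixes \<open>T\<close>, whose letters
  do not occur in these geodesics.\<close>

lemma map_conj_Geo_in_class:
  assumes "language_class C" "U \<subseteq> N" "Geo G letters U \<in> C letters" "g \<in> carrier G"
  shows "map (conj_by g) ` Geo G letters U \<in> C letters"
proof -
  define f where "f z = (if z \<in> B then conj_by g z else z)" for z
  have "bij_betw f B B"
    using conj_by_bij_B[OF assms(4)] bij_betw_cong[of B f "conj_by g" B] by (simp add: f_def)
  moreover have "f z = z" if "z \<in> T" for z
    using that B_subset T_subset by (auto simp: f_def)
  then have "bij_betw f T T"
    using bij_betw_cong[of T f id T] by simp
  ultimately have "bij_betw f letters letters"
    using B_subset T_subset by (intro bij_betw_combine) auto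
  then have "map f ` Geo G letters U \<in> C letters"
    using language_class_rename[OF assms(1) finite_letters _ assms(3)] by blast
  moreover have "map f ` Geo G letters U = map (conj_by g) ` Geo G letters U"
    using Geo_subset_lists_B[OF assms(2)] by (intro image_cong) (auto simp: f_def)
  ultimately show ?thesis by simp
qed

text \<open>Although \<open>G\<close> may be infinite, a renamed copy depends only on the
  restriction of \<open>conj_by g\<close> to \<open>B\<close>, and there are finitely many maps from
  \<open>B\<close> to \<open>B\<close>.\<close>

lemma ConjGeo_in_class:
  assumes "language_class C" "closed_under_finite_unions C" "U \<subseteq> N" "Geo G letters U \<in> C letters"
  shows "ConjGeo G letters U \<in> C letters"
proof -
  define \<F> where "\<F> = (\<lambda>g. map (conj_by g) ` Geo G letters U) ` carrier G"
  have "\<F> \<subseteq> (\<lambda>f. map f ` Geo G letters U) ` (B \<rightarrow>\<^sub>E B)"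
  proof (unfold \<F>_def, rule image_subsetI)
    fix g assume g: "g \<in> carrier G"
    have "map (conj_by g) ` Geo G letters U = map (restrict (conj_by g) B) ` Geo G letters U"
      using Geo_subset_lists_B[OF assms(3)] by (intro image_cong) auto
    moreover have "restrict (conj_by g) B \<in> B \<rightarrow>\<^sub>E B" using B_conj g by auto
    ultimately show "map (conj_by g) ` Geo G letters U
        \<in> (\<lambda>f. map f ` Geo G letters U) ` (B \<rightarrow>\<^sub>E B)" by blast
  qed
  then have "finite \<F>" using B_finite by (meson finite_PiE finite_imageI finite_subset)
  moreover have "\<F> \<noteq> {}" "\<F> \<subseteq> C letters"
    using map_conj_Geo_in_class[OF assms(1,3,4)] by (auto simp: \<F>_def)
  ultimately have "\<Union>\<F> \<in> C letters"
    using assms(2) finite_letters unfolding closed_under_finite_unions_def by blast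
  then show ?thesis
    using assms(3) by (simp add: \<F>_def ConjGeo_eq_Geo_conj_closure Geo_conj_closure)
qed

end

section \<open>Shortlex representatives of geodesics over \<open>B\<close>\<close>

context adapted_generators
begin

text \<open>The counts need only dominate those of \<open>w\<close>, which makes \<open>beaten r\<close> upward closed.\<close>

definition beaten :: "('a \<times> 'a) set \<Rightarrow> ('a \<Rightarrow> nat) \<Rightarrow> bool"
  where "beaten r n \<longleftrightarrow> (\<exists>v w. v \<in> lists B \<and> w \<in> lists B \<and> sorted_wrt (\<lambda>x y. (x, y) \<in> r) w \<and>
    word_eval G v = word_eval G w \<and> (v, w) \<in> lex (r - Id) \<and> (\<forall>a\<in>letters. count (mset w) a \<le> n a))"

text \<open>A smaller rival of a sorted word contained in \<open>w\<close> yields a smaller rival of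
  \<open>w\<close> itself, by exchanging the contained letters.\<close>

lemma beaten_sorted_word:
  assumes "antisym r" and w: "w \<in> lists B" "sorted_wrt (\<lambda>x y. (x, y) \<in> r) w"
    and "beaten r (count (mset w))"
  shows "\<exists>v\<in>lists B. word_eval G v = word_eval G w \<and> (v, w) \<in> lex (r - Id)"
proof -
  obtain v0 w0 where 0: "v0 \<in> lists B" "w0 \<in> lists B" "sorted_wrt (\<lambda>x y. (x, y) \<in> r) w0"
    "word_eval G v0 = word_eval G w0" "(v0, w0) \<in> lex (r - Id)"
    and le: "\<And>a. a \<in> letters \<Longrightarrow> count (mset w0) a \<le> count (mset w) a"
    using assms(4) unfolding beaten_def by blast
  have "count (mset w0) a \<le> count (mset w) a" for a
  proof (cases "a \<in> letters")
    case False
    then have "a \<notin># mset w0" using 0(2) by auto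
    then have "count (mset w0) a = 0" by (simp only: not_in_iff)
    then show ?thesis by linarith
  qed (rule le)
  then have "mset w0 \<subseteq># mset w" unfolding subseteq_mset_def by blast
  then obtain v where v: "(v, w) \<in> lex (r - Id)" "mset v + mset w0 = mset w + mset v0"
    using lex_sorted_supermultiset[OF assms(1) 0(3) w(2) _ 0(5)] by blast
  have "set v \<subseteq> set w \<union> set v0"
    using arg_cong[OF v(2), of set_mset] by auto
  then have vB: "v \<in> lists B" using w(1) 0(1) by auto
  \<comment> \<open>The multiset identity gives \<open>v @ w0\<close> and \<open>w @ v0\<close> the
    same value; the common value of \<open>w0\<close> and \<open>v0\<close> then cancels.\<close>
  have "word_eval G v \<otimes> word_eval G w0 = word_eval G (v @ w0)"
    using vB 0 lists_B_carrier by (simp only: word_eval_append)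
  also have "\<dots> = word_eval G (w @ v0)"
    using vB w 0 v(2) by (intro word_eval_mset_cong) auto
  also have "\<dots> = word_eval G w \<otimes> word_eval G v0"
    using w(1) 0 lists_B_carrier by (simp only: word_eval_append)
  finally have "word_eval G v \<otimes> word_eval G w0 = word_eval G w \<otimes> word_eval G w0"
    using 0(4) by simp
  then have "word_eval G v = word_eval G w"
    using vB w(1) 0(2) word_eval_N mem_carrier by simp
  then show ?thesis using vB v(1) by blast
qed

text \<open>Swapping an adjacent descent keeps the value and gives a smaller word, so least words
  are sorted. Conversely, a smaller rival of the geodesic \<open>w\<close> has the same length,
  hence is itself a geodesic over \<open>B\<close> and witnesses \<open>beaten\<close> at the counts
  of \<open>w\<close>.\<close>

lemma shortlex_rep_iff:
  assumes r: "linear_order_on letters r" and w: "w \<in> lists B" "length w = word_length G letters (word_eval G w)"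
  shows "w = shortlex_rep G letters r (word_eval G w) \<longleftrightarrow>
    sorted_wrt (\<lambda>x y. (x, y) \<in> r) w \<and> \<not> beaten r (count (mset w))"
proof
  assume eq: "w = shortlex_rep G letters r (word_eval G w)"
  note least = shortlex_rep_least(3)[OF finite_letters r sym_gens_letters lists_B_letters[OF w(1)] refl,
    folded eq]
  have asym: "asym (lenlex (r - Id))"
    using r by (intro asym_lenlex) (auto simp: order_on_defs intro!: asymI dest: antisymD)
  have not_less: "(v, w) \<notin> lex (r - Id)" if "v \<in> lists B" "word_eval G v = word_eval G w" for v
  proof
    assume "(v, w) \<in> lex (r - Id)"
    then have vw: "(v, w) \<in> lenlex (r - Id)" by (simp add: lenlex_conv lex_conv)
    then have "v \<noteq> w" using asym by (auto dest: asymD)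
    then show False using vw least[OF lists_B_letters] that asym by (auto dest: asymD)
  qed
  have "sorted_wrt (\<lambda>x y. (x, y) \<in> r) w"
  proof (rule ccontr)
    assume "\<not> ?thesis"
    moreover have "transp (\<lambda>x y. (x, y) \<in> r)"
      using r by (auto simp: order_on_defs transp_def dest: transD)
    ultimately obtain u a b v where uv: "w = u @ a # b # v" and "(a, b) \<notin> r"
      using not_sorted_wrt_descent by blast
    have ab: "a \<in> letters" "b \<in> letters" using w(1) uv by auto
    have "refl_on letters r" and total: "total_on letters r"
      using r by (auto simp: order_on_defs)
    then have "a \<noteq> b" using \<open>(a, b) \<notin> r\<close> ab(1) refl_onD by metis
    then have "(b, a) \<in> r - Id"
      using total[unfolded total_on_def, rule_format, OF ab] \<open>(a, b) \<notin> r\<close> by blast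
    then have "(u @ b # a # v, w) \<in> lex (r - Id)"
      using uv by (auto intro: lex_append_leftI)
    moreover have "word_eval G (u @ b # a # v) = word_eval G w"
      using w(1) uv by (intro word_eval_mset_cong) auto
    ultimately show False using not_less[of "u @ b # a # v"] w(1) uv by auto
  qed
  moreover have "\<not> beaten r (count (mset w))"
    using beaten_sorted_word[of r w] calculation w(1) not_less r by (auto simp: order_on_defs)
  ultimately show "sorted_wrt (\<lambda>x y. (x, y) \<in> r) w \<and> \<not> beaten r (count (mset w))" by blast
next
  assume sorted: "sorted_wrt (\<lambda>x y. (x, y) \<in> r) w \<and> \<not> beaten r (count (mset w))"
  have "shortlex_rep G letters r (word_eval G w) = w"
  proof (rule shortlex_rep_eqI)
    show "asym (r - Id)"
      using r by (auto simp: order_on_defs intro!: asymI dest: antisymD)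
    show "w \<in> lists (sym_gens G letters)" using w(1) lists_B_letters by simp
    fix v assume v: "v \<in> lists (sym_gens G letters)" "word_eval G v = word_eval G w" "v \<noteq> w"
    show "(w, v) \<in> lenlex (r - Id)"
    proof (cases "length v = length w")
      case True
      then have "v \<in> lists B"
        using geodesic_in_lists_B[of v] v w word_eval_N by simp
      then have "(v, w) \<notin> lex (r - Id)"
        using sorted v(2) w(1) unfolding beaten_def by blast
      moreover have "total_on letters (r - Id)"
        using r by (auto simp: linear_order_on_def total_on_def)
      ultimately have "(w, v) \<in> lex (r - Id)"
        using lex_total_on_lists[of letters "r - Id" v w] v True lists_B_letters[OF w(1)] by simp
      then show ?thesis using True by (simp add: lenlex_conv)
    next
      case False
      moreover have "length w \<le> length v"
        using word_length_le[OF v(1)] v(2) w(2) by simp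
      ultimately show ?thesis by (simp add: lenlex_conv)
    qed
  qed simp
  then show "w = shortlex_rep G letters r (word_eval G w)" by simp
qed

lemma ConjMinLenSL_eq:
  assumes r: "linear_order_on letters r" and U: "U \<subseteq> N"
  shows "ConjMinLenSL G letters r U = ConjGeo G letters U \<inter>
    {w \<in> lists letters. sorted_wrt (\<lambda>x y. (x, y) \<in> r) w \<and> \<not> beaten r (count (mset w))}"
    (is "?L = ?R")
proof
  show "?L \<subseteq> ?R"
  proof
    fix w assume "w \<in> ?L"
    then obtain g where g: "g \<in> conj_closure G U" "w = shortlex_rep G letters r g"
      by (auto simp: ConjMinLenSL_def)
    then have "g \<in> N" using conj_closure_subset[OF U] by auto
    then obtain u where u: "u \<in> lists letters" "word_eval G u = g" "length u = word_length G letters g"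
      using letter_word_exists[of g] geodesic_word_exists[of _ G letters g] mem_carrier
      by (metis sym_gens_letters)
    note rep = shortlex_rep_least[OF finite_letters r sym_gens_letters u(1,2), folded g(2)]
    \<comment> \<open>The shortlex least word cannot be longer than the geodesic \<open>u\<close>,
      hence it is a geodesic too.\<close>
    have "length w \<le> length u"
      using rep(3)[of u] u by (cases "u = w") (auto dest: lenlex_length)
    then have geo: "length w = word_length G letters (word_eval G w)"
      using u(3) rep(1,2) word_length_le[of w G letters] by simp
    then have "w \<in> ConjGeo G letters U"
      using rep(1,2) g(1) by (auto simp: ConjGeo_eq_Geo_conj_closure[OF U] Geo_def)
    moreover have "w \<in> lists B" using geodesic_in_lists_B rep \<open>g \<in> N\<close> geo by simp
    ultimately show "w \<in> ?R"
      using shortlex_rep_iff[OF r _ geo] rep(1,2) g(2) by simp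
  qed
  show "?R \<subseteq> ?L"
  proof
    fix w assume w: "w \<in> ?R"
    then have geo: "w \<in> Geo G letters (conj_closure G U)"
      by (simp add: ConjGeo_eq_Geo_conj_closure[OF U])
    then have "w \<in> lists B" using Geo_subset_lists_B[OF conj_closure_subset[OF U]] by blast
    then have "w = shortlex_rep G letters r (word_eval G w)"
      using shortlex_rep_iff[OF r] w geo by (simp add: Geo_def)
    moreover have "word_eval G w \<in> conj_closure G U" using geo by (simp add: Geo_def)
    moreover have "word_length G letters (word_eval G w) = conj_length G letters (word_eval G w)"
      using conj_length_eq_word_length calculation(2) conj_closure_subset[OF U] by auto
    ultimately show "w \<in> ?L" unfolding ConjMinLenSL_def by blast
  qed
qed

lemma ConjMinLenSL_in_class:
  assumes "closed_under_regular_inter C" "U \<subseteq> N" "linear_order_on letters r"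
    and "ConjGeo G letters U \<in> C letters"
  shows "ConjMinLenSL G letters r U \<in> C letters"
proof -
  have up: "beaten r n" if "beaten r m" "\<And>a. a \<in> letters \<Longrightarrow> m a \<le> n a" for m n
    using that unfolding beaten_def by (meson le_trans)
  have "regular_language letters
      {w \<in> lists letters. sorted_wrt (\<lambda>x y. (x, y) \<in> r) w \<and> \<not> beaten r (count (mset w))}"
    by (rule regular_sorted_avoiding_upward_closed[OF finite_letters up])
  then show ?thesis
    using assms finite_letters unfolding ConjMinLenSL_eq[OF assms(3,2)] closed_under_regular_inter_def
    by blast
qed

end

section \<open>Existence of adapted generators\<close>

lemma (in normal) finite_transversal:
  assumes "finite (rcosets H)"
  shows "\<exists>R\<subseteq>carrier G. finite R \<and> (\<forall>g\<in>carrier G. \<exists>t\<in>R. g \<otimes> inv t \<in> H)"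
proof -
  define t :: "'a set \<Rightarrow> 'a" where "t C = (SOME x. x \<in> C)" for C
  have t: "t C \<in> C" if "C \<in> rcosets H" for C
    using rcosets_non_empty[OF that] some_in_eq t_def by auto
  have "g \<otimes> inv (t (H #> g)) \<in> H" if "g \<in> carrier G" for g
  proof -
    have "H #> g \<in> rcosets H" using that by (auto simp: RCOSETS_def)
    then obtain h where "h \<in> H" "t (H #> g) = h \<otimes> g" using t by (auto simp: r_coset_def)
    then show ?thesis using that by (simp add: inv_mult_group flip: m_assoc)
  qed
  moreover have "t ` (rcosets H) \<subseteq> carrier G"
    using t rcosets_carrier[OF is_group] by blast
  ultimately show ?thesis
    using assms by (intro exI[of _ "t ` (rcosets H)"]) (auto simp: RCOSETS_def)
qed

text \<open>Elements of \<open>H\<close> commute with \<open>P\<close>, so conjugation by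
  \<open>g\<close> on \<open>P\<close> depends only on the right coset of \<open>g\<close>; finitely
  many representatives suffice.\<close>

lemma (in normal) finite_conjugates_in_abelian:
  assumes "finite (rcosets H)" and comm: "\<And>a b. a \<in> H \<Longrightarrow> b \<in> H \<Longrightarrow> a \<otimes> b = b \<otimes> a"
    and "P \<subseteq> H" "finite P"
  shows "finite (\<Union>g\<in>carrier G. conj_by g ` P)"
proof -
  obtain R where R: "R \<subseteq> carrier G" "finite R" "\<And>g. g \<in> carrier G \<Longrightarrow> \<exists>t\<in>R. g \<otimes> inv t \<in> H"
    using finite_transversal[OF assms(1)] by blast
  have "conj_by g p \<in> (\<Union>t\<in>R. conj_by t ` P)" if g: "g \<in> carrier G" and p: "p \<in> P" for g p
  proof -
    obtain t where t: "t \<in> R" "g \<otimes> inv t \<in> H" using R(3)[OF g] by blast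
    have tc: "t \<in> carrier G" and pH: "p \<in> H" using R t p assms(3) by auto
    have "conj_by k p = p" if "k \<in> H" for k
      using comm[OF pH that] pH that unfolding conj_by_def
      by (simp add: m_assoc) (simp flip: m_assoc)
    then have "conj_by (g \<otimes> inv t) p = p" using t(2) by blast
    moreover have "conj_by g p = conj_by t (conj_by (g \<otimes> inv t) p)"
      using g tc pH by (simp add: conj_by_conj_by m_assoc)
    ultimately show ?thesis using t(1) p by auto
  qed
  then have "(\<Union>g\<in>carrier G. conj_by g ` P) \<subseteq> (\<Union>t\<in>R. conj_by t ` P)" by blast
  then show ?thesis using R(2) assms(4) by (meson finite_UN_I finite_imageI finite_subset)
qed

lemma (in normal) adapted_generators_exist:
  assumes "finite (rcosets H)" and comm: "\<And>a b. a \<in> H \<Longrightarrow> b \<in> H \<Longrightarrow> a \<otimes> b = b \<otimes> a"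
    and S: "S \<subseteq> carrier G" "finite S" "generate G S = carrier G"
  shows "\<exists>B T. adapted_generators H G B T"
proof -
  obtain R where R: "R \<subseteq> carrier G" "finite R" "\<And>g. g \<in> carrier G \<Longrightarrow> \<exists>t\<in>R. g \<otimes> inv t \<in> H"
    using finite_transversal[OF assms(1)] by blast
  \<comment> \<open>Including the transversal \<open>R\<close> gives every coset other than
    \<open>H\<close> a representative in \<open>T\<close>.\<close>
  define T0 where "T0 = (S \<union> R) - H"
  define T where "T = T0 \<union> m_inv G ` T0"
  \<comment> \<open>\<open>P0\<close> collects the generators in \<open>H\<close>, the products of
    two letters of \<open>T\<close> that fall into \<open>H\<close>, and the factors
    \<open>x \<otimes> y \<otimes> inv z\<close> needed to write \<open>x \<otimes> y\<close> as a
    letter of \<open>B\<close> times \<open>z\<close>. Closing under inversion and then conjugation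
    gives \<open>B\<close>.\<close>
  define P0 where "P0 = H \<inter> (S \<union> (\<lambda>(x, y). x \<otimes> y) ` (T \<times> T) \<union> (\<lambda>(x, y, z). x \<otimes> y \<otimes> inv z) ` (T \<times> T \<times> T))"
  define P where "P = P0 \<union> m_inv G ` P0"
  define B where "B = (\<Union>g\<in>carrier G. conj_by g ` P)"
  have T0: "T0 \<subseteq> carrier G - H" "finite T0" using S R by (auto simp: T0_def)
  have T: "T \<subseteq> carrier G - H" "finite T"
  proof -
    have "inv y \<notin> H" if "y \<in> T0" for y
      using that T0 by (metis DiffD1 DiffD2 inv_inv m_inv_closed subsetD)
    then show "T \<subseteq> carrier G - H" using T0 by (auto simp: T_def)
  qed (use T0 in \<open>simp add: T_def\<close>)
  have P: "P \<subseteq> H" "finite P" using S T by (auto simp: P_def P0_def)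
  have P_inv: "inv p \<in> P" if "p \<in> P" for p
  proof -
    have "inv (inv q) = q" if "q \<in> P0" for q using that mem_carrier by (simp add: P0_def)
    then show ?thesis using that by (auto simp: P_def)
  qed
  have "P \<subseteq> B"
  proof
    fix p assume "p \<in> P"
    then have "p = conj_by \<one> p" using P mem_carrier by (auto simp: conj_by_one)
    then show "p \<in> B" using \<open>p \<in> P\<close> unfolding B_def by blast
  qed
  then have P0_B: "P0 \<subseteq> B" by (auto simp: P_def)
  have "adapted_generators H G B T"
  proof (intro adapted_generators.intro adapted_generators_axioms.intro)
    show "H \<lhd> G" by (rule normal_axioms)
    show "a \<otimes> b = b \<otimes> a" if "a \<in> H" "b \<in> H" for a b by (rule comm[OF that])
    show B_H: "B \<subseteq> H" using P conj_by_in_normal by (auto simp: B_def)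
    show "finite B" unfolding B_def
      by (rule finite_conjugates_in_abelian[OF assms(1) comm P])
    show "inv x \<in> B" if x: "x \<in> B" for x
    proof -
      obtain g p where "g \<in> carrier G" "p \<in> P" "x = conj_by g p" using x by (auto simp: B_def)
      moreover have "p \<in> carrier G" using \<open>p \<in> P\<close> P by auto
      ultimately show ?thesis using P_inv by (auto simp: B_def inv_conj_by)
    qed
    show "conj_by g x \<in> B" if g: "g \<in> carrier G" and x: "x \<in> B" for g x
    proof -
      obtain h p where "h \<in> carrier G" "p \<in> P" "x = conj_by h p" using x by (auto simp: B_def)
      moreover have "p \<in> carrier G" using \<open>p \<in> P\<close> P by auto
      ultimately show ?thesis using g by (auto simp: B_def conj_by_conj_by)
    qed
    show "T \<subseteq> carrier G - H" "finite T" by fact+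
    show "inv y \<in> T" if "y \<in> T" for y
      using that T0 by (auto simp: T_def)
    show "y \<otimes> z \<in> B" if "y \<in> T" "z \<in> T" "y \<otimes> z \<in> H" for y z
      using that P0_B by (force simp: P0_def)
    show "\<exists>x\<in>B. \<exists>y'\<in>T. y \<otimes> z = x \<otimes> y'" if yz: "y \<in> T" "z \<in> T" "y \<otimes> z \<notin> H" for y z
    proof -
      have c: "y \<in> carrier G" "z \<in> carrier G" using yz T by auto
      then obtain t where t: "t \<in> R" "y \<otimes> z \<otimes> inv t \<in> H" using R(3) by blast
      have tc: "t \<in> carrier G" using t R by auto
      have eq: "y \<otimes> z = y \<otimes> z \<otimes> inv t \<otimes> t" using c tc by (simp add: m_assoc)
      \<comment> \<open>A representative in \<open>H\<close> would force
        \<open>y \<otimes> z\<close> into \<open>H\<close>; hence \<open>t\<close> lies in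
        \<open>T\<close> and \<open>y \<otimes> z \<otimes> inv t\<close> is one of the factors in
        \<open>P0\<close>.\<close>
      then have "t \<notin> H" using yz(3) t(2) by (metis subgroup.m_closed[OF subgroup_axioms])
      then have "t \<in> T" using t(1) by (simp add: T_def T0_def)
      moreover have "y \<otimes> z \<otimes> inv t \<in> P0"
        using t(2) yz \<open>t \<in> T\<close> by (force simp: P0_def)
      ultimately show ?thesis using eq P0_B by blast
    qed
    show "generate G (B \<union> T) = carrier G"
    proof
      have BT: "B \<union> T \<subseteq> carrier G" using B_H T subset by blast
      then show "generate G (B \<union> T) \<subseteq> carrier G" by (rule generate_incl)
      have "S \<subseteq> B \<union> T" using P0_B by (auto simp: P0_def T_def T0_def)
      then show "carrier G \<subseteq> generate G (B \<union> T)"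
        using mono_generate S(3) by blast
    qed
  qed
  then show ?thesis by blast
qed

theorem theorem7p3:
  fixes G :: "('a, 'b) monoid_scheme" (structure)
    and N U :: "'a set"
    and C :: "'a set \<Rightarrow> 'a list set set"
  assumes "finitely_generated_group G"
    and "N \<lhd> G"
    and "comm_group (G\<lparr>carrier := N\<rparr>)"
    and "finite (rcosets N)"
    and "U \<subseteq> N"
    and "language_class C"
    and "closed_under_finite_unions C"
    and "closed_under_regular_inter C"
  shows "\<exists>Z \<subseteq> carrier G. finite Z \<and> generate G Z = carrier G \<and>
    (Geo G Z U \<in> C (sym_gens G Z) \<longrightarrow>
      ConjGeo G Z U \<in> C (sym_gens G Z) \<and>
      (\<forall>r. linear_order_on (sym_gens G Z) r \<longrightarrow>
        ConjMinLenSL G Z r U \<in> C (sym_gens G Z)))"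
proof -
  interpret normal N G by fact
  have comm: "a \<otimes> b = b \<otimes> a" if "a \<in> N" "b \<in> N" for a b
    using comm_groupE(4)[OF assms(3)] that by simp
  obtain S where "S \<subseteq> carrier G" "finite S" "generate G S = carrier G"
    using assms(1) by (auto simp: finitely_generated_group_def)
  then obtain B T where "adapted_generators N G B T"
    using adapted_generators_exist[OF assms(4) comm] by blast
  then interpret adapted_generators N G B T .
  \<comment> \<open>The generating set was built from \<open>G\<close>, \<open>N\<close> and
    \<open>S\<close> alone, so it serves every order \<open>r\<close> at once.\<close>
  show ?thesis
    using letters_closed finite_letters generates
      ConjGeo_in_class[OF assms(6,7,5)] ConjMinLenSL_in_class[OF assms(8,5)]
    by (intro exI[of _ letters]) simp
qed

end
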